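(* Let $r\ge 0$ be an integer, let $m_1,\ldots,m_r$ be positive integers, put $m:=m_1+\cdots+m_r$, and let $n$ be a non-negative integer. Let $a,b,c,f_1,\ldots,f_r$ be complex numbers and put $\sigma:=c-a-b-1$. Assume that the parameters are such that no zero denominators occur, i.e. $(c)_n\ne 0$, $(c-a-b-m)_n\neq 0$, $(f_j)_n\ne0$ and $(f_j)_{m_j}\neq 0$ for $1\le j\le r$, $(c-a-m)_m\ne 0$, $(c-b-m)_m\neq 0$, and that the polynomial $\hat Q_m(t)$ (defined in the context from $a,b,c,(f_j),(m_j)$) has degree $m$. Let $\eta_1,\ldots,\eta_m$ be the zeros of $\hat Q_m(t)$, counted with multiplicity (they are all nonzero, since $\hat Q_m(0)=1$). Then $$ {}_{r+3}F_{r+2}\left[\begin{array}{c}-n,\ a,\ b,\ f_1+m_1,\ldots,f_r+m_r\\ c,\ m-n-\sigma,\ f_1,\ldots,f_r\end{array};1\right] =\frac{(c-a-m)_n\,(c-b-m)_n}{(c)_n\,(c-a-b-m)_n}\,H_n, $$ where $$ H_n:=\frac{(\eta_1+1)_n\cdots(\eta_m+1)_n}{(\eta_1)_n\cdots(\eta_m)_n}=\hat Q_m(-n). $$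
   Context: Notation. $(x)_k$ is the Pochhammer symbol: $(x)_0=1$, $(x)_k=x(x+1)\cdots(x+k-1)$ for $k\ge1$. The generalized hypergeometric series is $${}_pF_q\left[\begin{array}{c}a_1,\ldots,a_p\\ b_1,\ldots,b_q\end{array};z\right]=\sum_{k\ge0}\frac{(a_1)_k\cdots(a_p)_k}{(b_1)_k\cdots(b_q)_k}\frac{z^k}{k!}.$$ When a numerator parameter is $-n$ with $n$ a non-negative integer, the series is the finite sum over $0\le k\le n$. Empty products equal $1$ and empty parameter lists (case $r=0$, $m=0$) are allowed. Coefficients $C_{k,r}$. Let $\Lambda=(f_1)_{m_1}\cdots(f_r)_{m_r}$ and define $\sigma_0,\ldots,\sigma_m$ by the polynomial identity $(f_1+x)_{m_1}\cdots(f_r+x)_{m_r}=\sum_{j=0}^m\sigma_jx^j$. For $0\le k\le m$ set $$C_{k,r}=\frac1\Lambda\sum_{j=k}^m\sigma_j\,\mathbf S_j^{(k)},$$ where $\mathbf S_j^{(k)}$ is the Stirling number of the second kind (so $C_{0,r}=1$ and $C_{m,r}=1/\Lambda$). (The coefficients $\sigma_j$ are unrelated to $\sigma=c-a-b-1$.) Polynomial $\hat Q_m$. For $0\le k\le m$ put $$G_{m,k}(t)={}_3F_2\left[\begin{array}{c}-m+k,\ t+k,\ c-a-b-m\\ c-a-m+k,\ c-b-m+k\end{array};1\right],$$ a finite sum over indices $0,\ldots,m-k$, hence a polynomial in $t$, and $$\hat Q_m(t)=\sum_{k=0}^m\frac{(-1)^kC_{k,r}\,(a)_k(b)_k(t)_k}{(c-a-m)_k(c-b-m)_k}\,G_{m,k}(t).$$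 It satisfies $\hat Q_m(0)=1$. Convention: each quotient $(\eta_j+1)_n/(\eta_j)_n$ is understood as $(\eta_j+n)/\eta_j$, so that $H_n=\prod_{j=1}^m (n+\eta_j)/\eta_j$. *)

theory Defs
  imports
    "HOL-Analysis.Analysis"
    "HOL-Computational_Algebra.Computational_Algebra"
    "HOL-Combinatorics.Stirling"
begin

definition hypergeom :: "complex list \<Rightarrow> complex list \<Rightarrow> complex \<Rightarrow> complex" where
  "hypergeom as bs z = eval_fps (fps_hypergeo as bs 1) z"

lemma hypergeom_altdef:
  "hypergeom as bs z =
     (\<Sum>k. (\<Prod>a\<leftarrow>as. pochhammer a k) / (\<Prod>b\<leftarrow>bs. pochhammer b k) * (z ^ k / fact k))"
proof -
  have *: "foldl (\<lambda>r a. r * pochhammer a k) x xs = x * (\<Prod>a\<leftarrow>xs. pochhammer a k)"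
    for k and x :: complex and xs
    by (induction xs arbitrary: x) (auto simp: mult_ac)
  show ?thesis
    by (simp add: hypergeom_def eval_fps_def * field_simps)
qed

text \<open>
  Beyond the index \<open>n\<close> the summands of a series with numerator parameter \<open>-n\<close> vanish, also
  where the denominator vanishes, because \<open>0 / 0 = 0\<close>.
\<close>

lemma hypergeom_terminating:
  "hypergeom (- of_nat n # as) bs z =
     (\<Sum>k\<le>n. (\<Prod>a\<leftarrow>- of_nat n # as. pochhammer a k) / (\<Prod>b\<leftarrow>bs. pochhammer b k)
        * (z ^ k / fact k))"
  unfolding hypergeom_altdef
  by (rule suminf_finite) (auto simp: pochhammer_of_nat_eq_0_iff)

text \<open>Throughout, the parameter families are \<open>f 1, \<dots>, f r\<close> and \<open>ms 1, \<dots>, ms r\<close>.\<close>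

definition msum :: "nat \<Rightarrow> (nat \<Rightarrow> nat) \<Rightarrow> nat" where
  "msum r ms = (\<Sum>j=1..r. ms j)"

definition Lam :: "nat \<Rightarrow> (nat \<Rightarrow> complex) \<Rightarrow> (nat \<Rightarrow> nat) \<Rightarrow> complex" where
  "Lam r f ms = (\<Prod>j=1..r. pochhammer (f j) (ms j))"

definition sig :: "nat \<Rightarrow> (nat \<Rightarrow> complex) \<Rightarrow> (nat \<Rightarrow> nat) \<Rightarrow> nat \<Rightarrow> complex" where
  "sig r f ms j = coeff (\<Prod>i=1..r. pochhammer [:f i, 1:] (ms i)) j"

definition Ccoeff :: "nat \<Rightarrow> (nat \<Rightarrow> complex) \<Rightarrow> (nat \<Rightarrow> nat) \<Rightarrow> nat \<Rightarrow> complex" where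
  "Ccoeff r f ms k =
     1 / Lam r f ms * (\<Sum>j=k..msum r ms. sig r f ms j * of_nat (Stirling j k))"

definition Gfun :: "complex \<Rightarrow> complex \<Rightarrow> complex \<Rightarrow> nat \<Rightarrow> nat \<Rightarrow> complex \<Rightarrow> complex" where
  "Gfun a b c m k t =
     hypergeom [- of_nat m + of_nat k, t + of_nat k, c - a - b - of_nat m]
       [c - a - of_nat m + of_nat k, c - b - of_nat m + of_nat k] 1"

definition Qhat ::
  "complex \<Rightarrow> complex \<Rightarrow> complex \<Rightarrow> nat \<Rightarrow> (nat \<Rightarrow> complex) \<Rightarrow> (nat \<Rightarrow> nat) \<Rightarrow> complex \<Rightarrow> complex" where
  "Qhat a b c r f ms t =
     (let m = msum r ms in
      \<Sum>k=0..m. (-1) ^ k * Ccoeff r f ms k * pochhammer a k * pochhammer b k * pochhammer t k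
        / (pochhammer (c - a - of_nat m) k * pochhammer (c - b - of_nat m) k) * Gfun a b c m k t)"

text \<open>Existence and uniqueness of this polynomial are part of the proof of \<open>poly_Qhat_poly\<close> below.\<close>

definition Qhat_poly ::
  "complex \<Rightarrow> complex \<Rightarrow> complex \<Rightarrow> nat \<Rightarrow> (nat \<Rightarrow> complex) \<Rightarrow> (nat \<Rightarrow> nat) \<Rightarrow> complex poly" where
  "Qhat_poly a b c r f ms = (THE p. \<forall>t. poly p t = Qhat a b c r f ms t)"

lemma poly_pochhammer: "poly (pochhammer p n) x = pochhammer (poly p x) n"
  for p :: "'a :: comm_semiring_1 poly"
  by (simp add: pochhammer_prod poly_prod)

lemma Gfun_is_poly:
  assumes "k \<le> m"
  shows "\<exists>p. \<forall>t. poly p t = Gfun a b c m k t"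
proof -
  define w where "w = (\<lambda>i. pochhammer (- of_nat (m - k)) i * pochhammer (c - a - b - of_nat m) i
    / (pochhammer (c - a - of_nat m + of_nat k) i * pochhammer (c - b - of_nat m + of_nat k) i)
    / fact i :: complex)"
  have [simp]: "- of_nat m + of_nat k = (- of_nat (m - k) :: complex)"
    using assms by (simp add: of_nat_diff)
  have "poly (\<Sum>i\<le>m-k. smult (w i) (pochhammer [:of_nat k, 1:] i)) t = Gfun a b c m k t" for t
    unfolding Gfun_def \<open>- of_nat m + of_nat k = _\<close> hypergeom_terminating
    by (simp add: poly_sum poly_pochhammer w_def mult_ac add_ac)
  thus ?thesis by blast
qed

lemma poly_Qhat_poly: "poly (Qhat_poly a b c r f ms) t = Qhat a b c r f ms t"
proof -
  define m where "m = msum r ms"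
  have "\<forall>k. \<exists>p. k \<le> m \<longrightarrow> (\<forall>t. poly p t = Gfun a b c m k t)"
    using Gfun_is_poly by blast
  then obtain g where g: "\<And>k t. k \<le> m \<Longrightarrow> poly (g k) t = Gfun a b c m k t"
    by metis
  define p where "p = (\<Sum>k=0..m. smult ((-1) ^ k * Ccoeff r f ms k * pochhammer a k * pochhammer b k
        / (pochhammer (c - a - of_nat m) k * pochhammer (c - b - of_nat m) k))
      (pochhammer [:0, 1:] k * g k))"
  have p: "\<forall>t. poly p t = Qhat a b c r f ms t"
    unfolding Qhat_def Let_def m_def[symmetric] p_def
    by (auto simp: poly_sum poly_pochhammer g mult_ac intro!: sum.cong)
  have "\<forall>t. poly (Qhat_poly a b c r f ms) t = Qhat a b c r f ms t"
    unfolding Qhat_poly_def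
    by (rule theI[of _ p]) (use p in \<open>auto simp: poly_eq_poly_eq_iff[symmetric] fun_eq_iff\<close>)
  thus ?thesis by blast
qed

text \<open>
  \<open>(\<eta> + n) / \<eta>\<close> stands for \<open>(\<eta> + 1)\<^sub>n / (\<eta>)\<^sub>n\<close>; the latter would be \<open>0\<close> if \<open>\<eta> \<in> {-(n-1), \<dots>, -1}\<close>.
\<close>

definition Hprod :: "nat \<Rightarrow> (nat \<Rightarrow> complex) \<Rightarrow> nat \<Rightarrow> complex" where
  "Hprod m \<eta> n = (\<Prod>j=1..m. (of_nat n + \<eta> j) / \<eta> j)"

lemma pochhammer_quotient:
  assumes "pochhammer x n \<noteq> 0" "x \<noteq> (0 :: complex)"
  shows "pochhammer (x + 1) n / pochhammer x n = (of_nat n + x) / x"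
proof -
  have "x * pochhammer (x + 1) n = pochhammer x n * (x + of_nat n)"
    by (metis pochhammer_rec pochhammer_rec' mult.commute)
  thus ?thesis using assms by (simp add: field_simps)
qed

end

theory Submission
  imports Defs
begin

text \<open>
  Put \<open>s = c - a - b - m\<close>. Since \<open>(f + m\<^sub>j)\<^sub>k / (f)\<^sub>k = (f + k)\<^sub>m\<^sub>j / (f)\<^sub>m\<^sub>j\<close>, the extra parameters contribute a polynomial
  in the summation index \<open>k\<close>, whose coefficients with respect to the falling factorials \<open>i! (k choose i)\<close>
  are the \<open>C\<^sub>i\<close>. Comparing the coefficients of \<open>C\<^sub>i\<close> on both sides reduces the claim to a transformation
  between two terminating \<open>\<^sub>3F\<^sub>2\<close> series of unit argument. In a division-free form that transformation follows by
  expanding \<open>(s + a + b - d + k)\<^sub>n\<^sub>-\<^sub>k\<close> with Vandermonde's identity and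
  summing over \<open>k\<close> with the Pfaff-Saalschuetz theorem.
\<close>

section \<open>Sums with binomial weights\<close>

text \<open>Pascal's rule splits each weight, and one of the two halves is shifted by one. This is
  how the induction step of \<open>pfaff_saalschuetz\<close> descends from \<open>Suc p\<close> to
  \<open>p\<close>.\<close>

lemma sum_binomial_Suc:
  fixes g :: "nat \<Rightarrow> 'a::comm_ring_1"
  shows "(\<Sum>k\<le>Suc n. of_nat (Suc n choose k) * g k) = (\<Sum>k\<le>n. of_nat (n choose k) * (g k + g (Suc k)))"
proof -
  have "(\<Sum>k\<le>Suc n. of_nat (Suc n choose k) * g k) =
      g 0 + (\<Sum>k\<le>n. of_nat (n choose Suc k) * g (Suc k)) + (\<Sum>k\<le>n. of_nat (n choose k) * g (Suc k))"
    by (subst sum.atMost_Suc_shift) (simp add: algebra_simps sum.distrib)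
  also have "g 0 + (\<Sum>k\<le>n. of_nat (n choose Suc k) * g (Suc k)) = (\<Sum>k\<le>Suc n. of_nat (n choose k) * g k)"
    by (subst sum.atMost_Suc_shift) simp
  also have "\<dots> = (\<Sum>k\<le>n. of_nat (n choose k) * g k)"
    by (simp add: binomial_eq_0)
  finally show ?thesis
    by (simp add: algebra_simps sum.distrib)
qed

text \<open>This and \<open>sum_binomial_absorb_comp\<close> apply the two absorption identities.
  Both extract the same factor \<open>Suc n\<close>, so sums weighted by \<open>k\<close> and by
  \<open>Suc n - k\<close> become comparable term by term.\<close>

lemma sum_binomial_absorb:
  fixes g :: "nat \<Rightarrow> 'a::comm_ring_1"
  shows "(\<Sum>k\<le>Suc n. of_nat (Suc n choose k) * (of_nat k * g k)) =
    of_nat (Suc n) * (\<Sum>k\<le>n. of_nat (n choose k) * g (Suc k))"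
proof -
  have "of_nat (Suc n choose Suc k) * (of_nat (Suc k) * g (Suc k)) =
      of_nat (Suc n) * (of_nat (n choose k) * g (Suc k))" for k
  proof -
    have "(Suc n choose Suc k) * Suc k = Suc n * (n choose k)"
      using Suc_times_binomial[of k n] by (simp only: mult.commute)
    from arg_cong[OF this, of "of_nat :: nat \<Rightarrow> 'a"] show ?thesis
      unfolding of_nat_mult by (simp only: mult.assoc[symmetric])
  qed
  thus ?thesis
    by (subst sum.atMost_Suc_shift) (simp add: sum_distrib_left del: of_nat_Suc binomial_Suc_Suc)
qed

lemma sum_binomial_absorb_comp:
  fixes g :: "nat \<Rightarrow> 'a::comm_ring_1"
  shows "(\<Sum>k\<le>Suc n. of_nat (Suc n choose k) * (of_nat (Suc n - k) * g k)) =
    of_nat (Suc n) * (\<Sum>k\<le>n. of_nat (n choose k) * g k)"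
proof -
  have *: "of_nat (Suc n choose k) * (of_nat (Suc n - k) * g k) =
      of_nat (Suc n) * (of_nat (n choose k) * g k)" for k
  proof -
    have "(Suc n choose k) * (Suc n - k) = Suc n * (n choose k)"
      using binomial_absorb_comp[of "Suc n" k] by (simp add: mult.commute)
    from arg_cong[OF this, of "of_nat :: nat \<Rightarrow> 'a"] show ?thesis
      unfolding of_nat_mult by (simp only: mult.assoc[symmetric])
  qed
  show ?thesis
    unfolding * sum_distrib_left[symmetric] by (simp add: binomial_eq_0)
qed

text \<open>Either product of two binomials is the trinomial coefficient n! / (k! l! (n-k-l)!),
  which is symmetric in \<open>k\<close> and \<open>l\<close>.\<close>

lemma sum_binomial_trinomial:
  fixes h :: "nat \<Rightarrow> nat \<Rightarrow> 'a::comm_ring_1"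
  shows "(\<Sum>k\<le>n. of_nat (n choose k) * (\<Sum>l\<le>n - k. of_nat (n - k choose l) * h k l)) =
    (\<Sum>l\<le>n. of_nat (n choose l) * (\<Sum>k\<le>n - l. of_nat (n - l choose k) * h k l))"
proof -
  have *: "of_nat (n choose k) * of_nat (n - k choose l) =
      (of_nat (n choose l) * of_nat (n - l choose k) :: 'a)" if "k + l \<le> n" for k l
  proof -
    have "(n choose k) * (n - k choose l) = (n choose l) * (n - l choose k)"
      using that choose_mult[of k "k + l" n] choose_mult[of l "k + l" n]
        binomial_symmetric[of k "k + l"] by simp
    thus ?thesis by (metis of_nat_mult)
  qed
  have "(\<Sum>k\<le>n. of_nat (n choose k) * (\<Sum>l\<le>n - k. of_nat (n - k choose l) * h k l)) =
      (\<Sum>(k, l)\<in>(SIGMA k:{..n}. {..n - k}). of_nat (n choose k) * of_nat (n - k choose l) * h k l)"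
    by (simp add: sum.Sigma[symmetric] sum_distrib_left mult.assoc)
  also have "\<dots> =
      (\<Sum>(l, k)\<in>(SIGMA l:{..n}. {..n - l}). of_nat (n choose l) * of_nat (n - l choose k) * h k l)"
    by (rule sum.reindex_bij_witness[of _ prod.swap prod.swap]) (auto simp: *)
  also have "\<dots> = (\<Sum>l\<le>n. of_nat (n choose l) * (\<Sum>k\<le>n - l. of_nat (n - l choose k) * h k l))"
    by (simp add: sum.Sigma[symmetric] sum_distrib_left mult.assoc)
  finally show ?thesis .
qed

section \<open>Vandermonde, Pfaff-Saalschuetz and the 3F2 transformation\<close>

text \<open>Vandermonde's identity expands the Pochhammer symbol of a sum. Reflecting first turns
  \<open>- d\<close> into \<open>d\<close>, and reflecting the remaining factor back restores
  \<open>x\<close>.\<close>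

lemma pochhammer_diff_binomial_sum:
  fixes x d :: "'a::comm_ring_1"
  shows "pochhammer (x - d) n =
    (\<Sum>l\<le>n. of_nat (n choose l) * ((-1) ^ l * pochhammer d l * pochhammer (x + of_nat l) (n - l)))"
proof -
  have reflect: "pochhammer y k = (-1) ^ k * pochhammer (1 - y - of_nat k) k" for y :: 'a and k
    using pochhammer_minus[of "- y" k] by (simp add: algebra_simps)
  have "pochhammer (x - d) n = (-1) ^ n * pochhammer (d + (1 - x - of_nat n)) n"
    by (subst reflect) (simp add: algebra_simps)
  also have "\<dots> = (\<Sum>l\<le>n. of_nat (n choose l) *
      ((-1) ^ n * pochhammer d l * pochhammer (1 - x - of_nat n) (n - l)))"
    by (simp add: pochhammer_binomial_sum sum_distrib_left mult_ac)
  also have "\<dots> = (\<Sum>l\<le>n. of_nat (n choose l) *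
      ((-1) ^ l * pochhammer d l * pochhammer (x + of_nat l) (n - l)))"
  proof (rule sum.cong[OF refl])
    fix l assume "l \<in> {..n}"
    hence l: "n = l + (n - l)" by simp
    \<comment> \<open>Reflection at \<open>y = x + l\<close> with \<open>k = n - l\<close> gives
      \<open>1 - y - k = 1 - x - n\<close>, free of \<open>l\<close>.\<close>
    have "pochhammer (x + of_nat l) (n - l) = (-1) ^ (n - l) * pochhammer (1 - x - of_nat n) (n - l)"
      by (subst reflect, subst (2) l, unfold of_nat_add) (simp add: algebra_simps)
    moreover have "(-1 :: 'a) ^ n = (-1) ^ l * (-1) ^ (n - l)"
      by (metis l power_add)
    ultimately show "of_nat (n choose l) *
        ((-1) ^ n * pochhammer d l * pochhammer (1 - x - of_nat n) (n - l)) =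
        of_nat (n choose l) * ((-1) ^ l * pochhammer d l * pochhammer (x + of_nat l) (n - l))"
      by (simp add: mult_ac)
  qed
  finally show ?thesis .
qed

text \<open>The classical sum is 3F2(-n, a, b; s+a+b, 1-s-n; 1); multiplication by (s)_n (s+a+b)_n
  removes all denominators. After Pascal's rule the main part is (s+a)(s+b) times the sum for
  \<open>n - 1\<close> and \<open>s + 1\<close>, exactly the recursion of the right-hand side. The
  induction is strong because the cancellation of the remainder uses the case
  \<open>n - 2\<close>.\<close>

lemma pfaff_saalschuetz:
  fixes s a b :: "'a::comm_ring_1"
  shows "(\<Sum>k\<le>n. of_nat (n choose k) * (pochhammer s (n - k) * pochhammer a k * pochhammer b k
      * pochhammer (s + a + b + of_nat k) (n - k))) = pochhammer (s + a) n * pochhammer (s + b) n"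
proof (induction n arbitrary: s a b rule: less_induct)
  case (less n)
  define S :: "nat \<Rightarrow> 'a \<Rightarrow> 'a \<Rightarrow> 'a \<Rightarrow> 'a" where
    "S = (\<lambda>n s a b. \<Sum>k\<le>n. of_nat (n choose k) * (pochhammer s (n - k) * pochhammer a k
      * pochhammer b k * pochhammer (s + a + b + of_nat k) (n - k)))"
  have IH: "S j s a b = pochhammer (s + a) j * pochhammer (s + b) j" if "j < n" for j s a b
    using less[OF that] by (simp add: S_def)
  have "S n s a b = pochhammer (s + a) n * pochhammer (s + b) n"
  proof (cases n)
    case 0
    thus ?thesis by (simp add: S_def)
  next
    case (Suc p)
    define g where "g = (\<lambda>k. pochhammer s (n - k) * pochhammer a k
      * pochhammer b k * pochhammer (s + a + b + of_nat k) (n - k))"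
    define h where "h = (\<lambda>k. pochhammer (s + 1) (p - k) * pochhammer a k
      * pochhammer b k * pochhammer (s + 1 + a + b + of_nat k) (p - k))"
    define u where "u = (\<lambda>k. (s + a + b + of_nat p) * (pochhammer s (p - k) * pochhammer a k
      * pochhammer b k * pochhammer (s + 1 + a + b + of_nat k) (p - k)))"
    define v where "v = (\<lambda>k. a * b * (pochhammer (s + 1) (p - k - 1) * pochhammer a k
      * pochhammer b k * pochhammer (s + 1 + a + b + of_nat k) (p - k)))"
    \<comment> \<open>The terms with \<open>u\<close> and \<open>v\<close> sum to the same multiple of \<open>S (p - 1) s (a + 1) (b + 1)\<close> and
      \<open>S (p - 1) (s + 1) a b\<close>, which have equal closed forms by induction.\<close>
    have step: "g k + g (Suc k) = (s + a) * (s + b) * h k + (of_nat k * u k - of_nat (p - k) * v k)"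
      if "k \<le> p" for k
    proof -
      define j where "j = p - k"
      have p: "p = k + j" using that by (simp add: j_def)
      have e: "s + a + b + of_nat (Suc k) = s + 1 + a + b + of_nat k" by simp
      have g1: "g k = (pochhammer s j * (s + of_nat j)) * pochhammer a k * pochhammer b k
          * ((s + a + b + of_nat k) * pochhammer (s + 1 + a + b + of_nat k) j)"
        using pochhammer_rec[of "s + a + b + of_nat k" j]
        by (simp add: g_def Suc p pochhammer_Suc[of s] Suc_diff_le add_ac)
      have g2: "g (Suc k) = pochhammer s j * (pochhammer a k * (a + of_nat k)) * (pochhammer b k * (b + of_nat k))
          * pochhammer (s + 1 + a + b + of_nat k) j"
        unfolding g_def e by (simp add: Suc p pochhammer_Suc)
      \<comment> \<open>For \<open>j = 0\<close> the index \<open>p - k - 1\<close> in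
        \<open>v\<close> is truncated to 0, harmlessly, since the weight \<open>p - k\<close> is 0
        too. For \<open>j = Suc i\<close> every term is a multiple of
        \<open>pochhammer (s + 1) i\<close>, and a polynomial identity remains.\<close>
      show ?thesis
      proof (cases j)
        case 0
        thus ?thesis unfolding g1 g2 by (simp add: h_def u_def v_def p algebra_simps)
      next
        case (Suc i)
        have "pochhammer (s + 1) j = pochhammer (s + 1) i * (s + of_nat j)" 
             "pochhammer s j = s * pochhammer (s + 1) i"
          using pochhammer_Suc[of "s + 1" i] pochhammer_rec[of s i] by (simp_all add: Suc add_ac)
        moreover have "p - k = j" "p - k - 1 = i" "of_nat p = (of_nat k + of_nat j :: 'a)"
          using p Suc by simp_all
        ultimately show ?thesis unfolding g1 g2 h_def u_def v_def
          by (simp only: ) (simp only: algebra_simps)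
      qed
    qed
    have "S n s a b = (\<Sum>k\<le>p. of_nat (p choose k) * (g k + g (Suc k)))"
      unfolding S_def g_def Suc by (rule sum_binomial_Suc)
    also have "\<dots> = (\<Sum>k\<le>p. (s + a) * (s + b) * (of_nat (p choose k) * h k) +
        (of_nat (p choose k) * (of_nat k * u k) - of_nat (p choose k) * (of_nat (p - k) * v k)))"
      by (intro sum.cong refl) (simp add: step algebra_simps)
    also have "\<dots> = (s + a) * (s + b) * S p (s + 1) a b +
        ((\<Sum>k\<le>p. of_nat (p choose k) * (of_nat k * u k)) -
         (\<Sum>k\<le>p. of_nat (p choose k) * (of_nat (p - k) * v k)))"
      by (simp add: sum.distrib sum_subtractf sum_distrib_left S_def h_def)
    also have "(\<Sum>k\<le>p. of_nat (p choose k) * (of_nat k * u k)) =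
        (\<Sum>k\<le>p. of_nat (p choose k) * (of_nat (p - k) * v k))"
    proof (cases p)
      case 0
      thus ?thesis by simp
    next
      case (Suc q)
      define w where "w = (s + a + b + of_nat p) * a * b"
      have "(\<Sum>k\<le>q. of_nat (q choose k) * u (Suc k)) = w * S q s (a + 1) (b + 1)"
        by (simp add: u_def w_def S_def Suc pochhammer_rec sum_distrib_left algebra_simps)
      also have "\<dots> = w * S q (s + 1) a b"
        using \<open>n = Suc p\<close> Suc by (simp add: IH algebra_simps)
      also have "\<dots> = (\<Sum>k\<le>q. of_nat (q choose k) * v k)"
        unfolding S_def sum_distrib_left
      proof (intro sum.cong refl)
        fix k assume "k \<in> {..q}"
        \<comment> \<open>The last factor of the longer product is \<open>s + a + b + p\<close>; it
          matches the constant in \<open>w\<close> that stems from \<open>u\<close>.\<close>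
        have "pochhammer (s + 1 + a + b + of_nat k) (p - k) =
            pochhammer (s + 1 + a + b + of_nat k) (q - k) * (s + a + b + of_nat p)"
          using Suc \<open>k \<in> {..q}\<close> by (simp add: Suc_diff_le pochhammer_Suc of_nat_diff add_ac)
        moreover have "p - k - 1 = q - k" using Suc by simp
        ultimately show "w * (of_nat (q choose k) * (pochhammer (s + 1) (q - k) * pochhammer a k
          * pochhammer b k * pochhammer (s + 1 + a + b + of_nat k) (q - k))) = of_nat (q choose k) * v k"
          by (simp only: v_def w_def mult_ac)
      qed
      finally show ?thesis
        unfolding Suc sum_binomial_absorb sum_binomial_absorb_comp by simp
    qed
    finally show ?thesis
      using Suc IH[of p "s + 1" a b] by (simp add: pochhammer_rec mult_ac add_ac)
  qed
  thus ?case by (simp add: S_def)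
qed

text \<open>The parameter \<open>d\<close> measures the distance from the Saalschuetzian case: for
  \<open>d = 0\<close> only the term \<open>l = 0\<close> survives on the right and the sum above
  returns.\<close>

lemma terminating_3F2_transform:
  fixes s a b d :: "'a::comm_ring_1"
  shows "(\<Sum>k\<le>n. of_nat (n choose k) * (pochhammer s (n - k) * pochhammer a k * pochhammer b k
      * pochhammer (s + a + b - d + of_nat k) (n - k))) =
    (\<Sum>l\<le>n. of_nat (n choose l) * ((-1) ^ l * pochhammer d l * pochhammer s l
      * pochhammer (s + a + of_nat l) (n - l) * pochhammer (s + b + of_nat l) (n - l)))"
proof -
  define h where "h = (\<lambda>k l. pochhammer s (n - k) * pochhammer a k * pochhammer b k *
    ((-1) ^ l * pochhammer d l * pochhammer (s + a + b + of_nat k + of_nat l) (n - k - l)))"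
  have "(\<Sum>k\<le>n. of_nat (n choose k) * (pochhammer s (n - k) * pochhammer a k * pochhammer b k
      * pochhammer (s + a + b - d + of_nat k) (n - k))) =
      (\<Sum>k\<le>n. of_nat (n choose k) * (\<Sum>l\<le>n - k. of_nat (n - k choose l) * h k l))"
  proof (intro sum.cong refl)
    fix k
    have "pochhammer (s + a + b - d + of_nat k) (n - k) = pochhammer (s + a + b + of_nat k - d) (n - k)"
      by (simp add: algebra_simps)
    thus "of_nat (n choose k) * (pochhammer s (n - k) * pochhammer a k * pochhammer b k
      * pochhammer (s + a + b - d + of_nat k) (n - k)) =
       of_nat (n choose k) * (\<Sum>l\<le>n - k. of_nat (n - k choose l) * h k l)"
      by (simp add: pochhammer_diff_binomial_sum h_def sum_distrib_left mult_ac)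
  qed
  also have "\<dots> = (\<Sum>l\<le>n. of_nat (n choose l) * (\<Sum>k\<le>n - l. of_nat (n - l choose k) * h k l))"
    by (rule sum_binomial_trinomial)
  also have "\<dots> = (\<Sum>l\<le>n. of_nat (n choose l) * ((-1) ^ l * pochhammer d l * pochhammer s l
      * pochhammer (s + a + of_nat l) (n - l) * pochhammer (s + b + of_nat l) (n - l)))"
  proof (intro sum.cong refl arg_cong2[of _ _ _ _ "(*)"])
    fix l assume l: "l \<in> {..n}"
    \<comment> \<open>Splitting (s)_(n-k) as (s)_l (s+l)_(n-k-l) makes the sum over \<open>k\<close>
      Saalschuetzian with \<open>s + l\<close> in place of \<open>s\<close> and \<open>n - l\<close>
      in place of \<open>n\<close>.\<close>
    have "h k l = (-1) ^ l * pochhammer d l * pochhammer s l * (pochhammer (s + of_nat l) (n - l - k)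
        * pochhammer a k * pochhammer b k
        * pochhammer (s + of_nat l + a + b + of_nat k) (n - l - k))" if "k \<le> n - l" for k
      using l that pochhammer_product[of l "n - k" s]
      by (simp add: h_def mult_ac add_ac diff_commute[of n l k])
    hence "(\<Sum>k\<le>n - l. of_nat (n - l choose k) * h k l) = (-1) ^ l * pochhammer d l * pochhammer s l *
        (\<Sum>k\<le>n - l. of_nat (n - l choose k) * (pochhammer (s + of_nat l) (n - l - k)
        * pochhammer a k * pochhammer b k * pochhammer (s + of_nat l + a + b + of_nat k) (n - l - k)))"
      by (simp add: sum_distrib_left mult_ac)
    thus "(\<Sum>k\<le>n - l. of_nat (n - l choose k) * h k l) = (-1) ^ l * pochhammer d l * pochhammer s l
      * pochhammer (s + a + of_nat l) (n - l) * pochhammer (s + b + of_nat l) (n - l)"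
      unfolding pfaff_saalschuetz by (simp add: mult_ac add_ac)
  qed
  finally show ?thesis .
qed

section \<open>Stirling numbers and the coefficients C_i\<close>

text \<open>The product \<open>fact i * (x choose i)\<close> is the falling factorial. Multiplying
  it by \<open>x = (x - i) + i\<close> reproduces the recurrence of the Stirling numbers.\<close>

lemma power_eq_sum_Stirling:
  "x ^ j = (\<Sum>i\<le>j. Stirling j i * (fact i * (x choose i)))" for x :: nat
proof (induction j)
  case (Suc j)
  define F :: "nat \<Rightarrow> nat" where "F = (\<lambda>i. fact i * (x choose i))"
  have F: "x * F i = F (Suc i) + i * F i" for i
  proof (cases "i \<le> x")
    case True
    have "x * F i = (x - i) * F i + i * F i"
      using True by (metis add_mult_distrib le_add_diff_inverse2)
    moreover have "(x - i) * F i = F (Suc i)"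
    proof -
      have "(x - i) * (x choose i) = Suc i * (x choose Suc i)"
        by (simp only: binomial_absorb_comp binomial_absorption)
      thus ?thesis by (simp only: F_def fact_Suc of_nat_id mult_ac)
    qed
    ultimately show ?thesis by simp
  qed (simp add: F_def binomial_eq_0)
  \<comment> \<open>The shift changes nothing: the term at index 0 has the factor 0, and the one at
    \<open>Suc j\<close> has \<open>Stirling j (Suc j) = 0\<close>.\<close>
  have shift: "(\<Sum>i\<le>j. Suc i * Stirling j (Suc i) * F (Suc i)) = (\<Sum>i\<le>j. i * Stirling j i * F i)"
  proof -
    have "(\<Sum>i\<le>j. Suc i * Stirling j (Suc i) * F (Suc i)) = (\<Sum>i\<le>Suc j. i * Stirling j i * F i)"
      by (subst sum.atMost_Suc_shift) simp
    thus ?thesis by simp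
  qed
  have "x ^ Suc j = (\<Sum>i\<le>j. Stirling j i * (x * F i))"
    by (simp add: Suc.IH F_def sum_distrib_left mult_ac)
  also have "\<dots> = (\<Sum>i\<le>j. Stirling j i * F (Suc i)) + (\<Sum>i\<le>j. i * Stirling j i * F i)"
    unfolding F by (simp add: sum.distrib algebra_simps)
  also have "\<dots> = (\<Sum>i\<le>j. Stirling (Suc j) (Suc i) * F (Suc i))"
    unfolding shift[symmetric] by (simp add: sum.distrib algebra_simps)
  also have "\<dots> = (\<Sum>i\<le>Suc j. Stirling (Suc j) i * F i)"
    by (subst sum.atMost_Suc_shift) simp
  finally show ?case by (simp add: F_def)
qed simp

lemma degree_pochhammer_linear_le: "degree (pochhammer [:x, 1:] n) \<le> n"
  for x :: "'a::comm_semiring_1"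
proof -
  have "degree (pochhammer [:x, 1:] n) \<le> sum (degree \<circ> (\<lambda>i. [:x, 1:] + of_nat i)) {0..<n}"
    unfolding pochhammer_prod by (rule degree_prod_sum_le) simp
  also have "\<dots> \<le> (\<Sum>i\<in>{0..<n}. 1)"
    by (intro sum_mono) (auto intro: degree_add_le)
  finally show ?thesis by simp
qed

text \<open>Stirling numbers pass from monomials to falling factorials, so
  \<open>Lam * Ccoeff i\<close> are the coefficients of the Newton expansion of the polynomial whose
  monomial coefficients are \<open>sig\<close>.\<close>

lemma prod_pochhammer_shift_eq_Ccoeff:
  assumes "Lam r f ms \<noteq> 0"
  shows "(\<Prod>j=1..r. pochhammer (f j + of_nat x) (ms j)) =
    Lam r f ms * (\<Sum>i\<le>msum r ms. Ccoeff r f ms i * (fact i * of_nat (x choose i)))"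
proof -
  define m where "m = msum r ms"
  define P where "P = (\<Prod>i=1..r. pochhammer [:f i, 1:] (ms i))"
  have sig: "sig r f ms j = coeff P j" for j
    by (simp add: sig_def P_def)
  have "degree P \<le> (\<Sum>i=1..r. degree (pochhammer [:f i, 1:] (ms i)))"
    unfolding P_def using degree_prod_sum_le[of "{1..r}"] by (simp add: o_def)
  also have "\<dots> \<le> m"
    unfolding m_def msum_def by (intro sum_mono degree_pochhammer_linear_le)
  finally have "P = (\<Sum>j\<le>m. monom (coeff P j) j)"
    by (simp add: poly_as_sum_of_monoms')
  hence "poly P (of_nat x) = (\<Sum>j\<le>m. coeff P j * of_nat x ^ j)"
    by (metis (no_types, lifting) poly_monom poly_sum sum.cong)
  also have "\<dots> = (\<Sum>j\<le>m. \<Sum>i\<le>m. coeff P j * of_nat (Stirling j i) * (fact i * of_nat (x choose i)))"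
  proof (intro sum.cong refl)
    fix j assume "j \<in> {..m}"
    have "(of_nat x ^ j :: complex) = of_nat (x ^ j)" by simp
    also have "\<dots> = (\<Sum>i\<le>j. of_nat (Stirling j i) * (fact i * of_nat (x choose i)))"
      unfolding power_eq_sum_Stirling by simp
    \<comment> \<open>\<open>Stirling j i\<close> vanishes for \<open>i > j\<close>; the enlarged
      range no longer depends on \<open>j\<close>, so the two sums can be swapped.\<close>
    also have "\<dots> = (\<Sum>i\<le>m. of_nat (Stirling j i) * (fact i * of_nat (x choose i)))"
      using \<open>j \<in> {..m}\<close> by (intro sum.mono_neutral_left) auto
    finally show "coeff P j * of_nat x ^ j =
        (\<Sum>i\<le>m. coeff P j * of_nat (Stirling j i) * (fact i * of_nat (x choose i)))"
      by (simp add: sum_distrib_left mult.assoc)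
  qed
  also have "\<dots> = (\<Sum>i\<le>m. (\<Sum>j\<le>m. coeff P j * of_nat (Stirling j i)) * (fact i * of_nat (x choose i)))"
    by (subst sum.swap) (simp add: sum_distrib_right)
  also have "\<dots> = (\<Sum>i\<le>m. Lam r f ms * Ccoeff r f ms i * (fact i * of_nat (x choose i)))"
  proof (intro sum.cong refl)
    fix i assume "i \<in> {..m}"
    have "(\<Sum>j\<le>m. coeff P j * of_nat (Stirling j i)) = (\<Sum>j=i..m. coeff P j * of_nat (Stirling j i))"
      by (intro sum.mono_neutral_right) auto
    thus "(\<Sum>j\<le>m. coeff P j * of_nat (Stirling j i)) * (fact i * of_nat (x choose i)) =
        Lam r f ms * Ccoeff r f ms i * (fact i * of_nat (x choose i))"
      using assms by (simp add: Ccoeff_def sig m_def)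
  qed
  also have "\<dots> = Lam r f ms * (\<Sum>i\<le>m. Ccoeff r f ms i * (fact i * of_nat (x choose i)))"
    by (simp add: sum_distrib_left mult_ac)
  finally show ?thesis
    by (simp add: P_def m_def poly_prod poly_pochhammer add_ac)
qed

section \<open>The contribution of a single C_i\<close>

lemma pochhammer_minus_of_nat:
  "pochhammer (- of_nat n) k = ((-1) ^ k * fact k * of_nat (n choose k) :: 'a::field_char_0)"
  using gbinomial_pochhammer[of "of_nat n :: 'a" k]
  by (simp add: binomial_gbinomial power_mult_distrib[symmetric] flip: mult.assoc)

text \<open>The factor \<open>k choose i\<close> kills the terms below \<open>i\<close>;
  \<open>choose_mult\<close> and a shift by \<open>i\<close> then leave a sum of the same shape over
  \<open>n - i\<close>.\<close>

lemma sum_binomial_times_choose: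
  fixes g :: "nat \<Rightarrow> 'a::comm_ring_1"
  assumes "i \<le> n"
  shows "(\<Sum>k\<le>n. of_nat (n choose k) * (of_nat (k choose i) * g k)) =
    of_nat (n choose i) * (\<Sum>k\<le>n - i. of_nat (n - i choose k) * g (i + k))"
proof -
  have "(\<Sum>k\<le>n. of_nat (n choose k) * (of_nat (k choose i) * g k)) =
      (\<Sum>k=i..n. of_nat (n choose k) * (of_nat (k choose i) * g k))"
    by (intro sum.mono_neutral_right) (auto simp: binomial_eq_0)
  also have "\<dots> = (\<Sum>k=i..n. of_nat (n choose i) * of_nat (n - i choose (k - i)) * g k)"
  proof (intro sum.cong refl)
    fix k assume "k \<in> {i..n}"
    hence "(n choose k) * (k choose i) = (n choose i) * (n - i choose (k - i))"
      by (intro choose_mult) auto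
    thus "of_nat (n choose k) * (of_nat (k choose i) * g k) =
        of_nat (n choose i) * of_nat (n - i choose (k - i)) * g k"
      by (metis mult.assoc of_nat_mult)
  qed
  also have "\<dots> = (\<Sum>k\<le>n - i. of_nat (n choose i) * of_nat (n - i choose k) * g (i + k))"
    using assms by (intro sum.reindex_bij_witness[of _ "\<lambda>k. i + k" "\<lambda>k. k - i"]) auto
  finally show ?thesis by (simp add: sum_distrib_left mult.assoc)
qed

text \<open>The prefactor clears the denominators of \<open>Gfun\<close> at \<open>t = -n\<close>
  and yields the right-hand side of \<open>terminating_3F2_transform\<close> for
  \<open>n - i\<close> and \<open>d = i - m\<close>.\<close>

lemma Gfun_eq_sum:
  assumes "i \<le> m" "i \<le> n"
    and "pochhammer (c - a - of_nat m) m \<noteq> 0" "pochhammer (c - b - of_nat m) m \<noteq> 0"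
  defines "s \<equiv> c - a - b - of_nat m"
  shows "pochhammer (c - a - of_nat m) n * pochhammer (c - b - of_nat m) n
      / (pochhammer (c - a - of_nat m) i * pochhammer (c - b - of_nat m) i) * Gfun a b c m i (- of_nat n) =
    (\<Sum>l\<le>n - i. of_nat (n - i choose l) * ((-1) ^ l * pochhammer (of_nat i - of_nat m) l * pochhammer s l
      * pochhammer (c - b - of_nat m + of_nat i + of_nat l) (n - i - l)
      * pochhammer (c - a - of_nat m + of_nat i + of_nat l) (n - i - l)))"
proof -
  define A B where "A = c - a - of_nat m" and "B = c - b - of_nat m"
  define d :: complex where "d = of_nat i - of_nat m"
  define g where "g = (\<lambda>l. of_nat (n - i choose l) * ((-1) ^ l * pochhammer d l * pochhammer s l
      * pochhammer (B + of_nat i + of_nat l) (n - i - l)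
      * pochhammer (A + of_nat i + of_nat l) (n - i - l)))"
  have neg: "- of_nat m + of_nat i = (- of_nat (m - i) :: complex)"
    "of_nat i - of_nat n = (- of_nat (n - i) :: complex)" "d = - of_nat (m - i)"
    using assms by (auto simp: of_nat_diff d_def)
  \<comment> \<open>The hypothesis concerns (x)_m; because \<open>i + l \<le> m\<close> it passes to
    (x)_(i+l), which contains every factor divided by.\<close>
  have split: "pochhammer x n / pochhammer x i / pochhammer (x + of_nat i) l =
      pochhammer (x + of_nat i + of_nat l) (n - i - l)"
    if "pochhammer x m \<noteq> 0" "l \<le> m - i" "l \<le> n - i" for x :: complex and l
  proof -
    have "pochhammer x (i + l) \<noteq> 0"
      using that assms(1) by (intro pochhammer_neq_0_mono[of x m "i + l"]) auto
    moreover have "pochhammer x n = pochhammer x (i + l) * pochhammer (x + of_nat i + of_nat l) (n - i - l)"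
      using that assms(2) pochhammer_product[of "i + l" n x] by (simp add: add_ac)
    ultimately show ?thesis by (simp add: pochhammer_product'[of x i l])
  qed
  have "pochhammer A n * pochhammer B n / (pochhammer A i * pochhammer B i) * Gfun a b c m i (- of_nat n) =
      (\<Sum>l\<le>m - i. of_nat (n - i choose l) * ((-1) ^ l * pochhammer d l * pochhammer s l
      * (pochhammer B n / pochhammer B i / pochhammer (B + of_nat i) l)
      * (pochhammer A n / pochhammer A i / pochhammer (A + of_nat i) l)))"
    unfolding Gfun_def neg(1) hypergeom_terminating
    by (simp add: sum_distrib_left neg pochhammer_minus_of_nat[of "n - i"] s_def mult_ac
          flip: A_def B_def)
  also have "\<dots> = (\<Sum>l\<le>m - i. g l)"
  proof (intro sum.cong refl)
    fix l assume l: "l \<in> {..m - i}"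
    show "of_nat (n - i choose l) * ((-1) ^ l * pochhammer d l * pochhammer s l
      * (pochhammer B n / pochhammer B i / pochhammer (B + of_nat i) l)
      * (pochhammer A n / pochhammer A i / pochhammer (A + of_nat i) l)) = g l"
    proof (cases "l \<le> n - i")
      case True
      moreover have "l \<le> m - i" using l by simp
      ultimately show ?thesis
        by (simp only: g_def split[OF assms(3)[folded A_def]] split[OF assms(4)[folded B_def]])
    qed (simp add: g_def binomial_eq_0)
  qed
  \<comment> \<open>\<open>Gfun\<close> is summed up to \<open>m - i\<close>, the goal up to
    \<open>n - i\<close>. Beyond the first bound (d)_l is 0 as \<open>d = -(m - i)\<close>; beyond
    the second the binomial is 0. Both sums thus equal the one up to the maximum.\<close>
  also have "\<dots> = (\<Sum>l\<le>max (m - i) (n - i). g l)"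
    by (intro sum.mono_neutral_left) (auto simp: g_def neg pochhammer_of_nat_eq_0_lemma)
  also have "\<dots> = (\<Sum>l\<le>n - i. g l)"
    by (intro sum.mono_neutral_right) (auto simp: g_def binomial_eq_0)
  finally show ?thesis
    by (simp add: g_def A_def B_def d_def)
qed

text \<open>The two sides are what multiplies \<open>Ccoeff i\<close> in the series and in
  \<open>Qhat\<close>, once the denominators (c)_n (s)_n are multiplied out.\<close>

lemma sum_binomial_choose_eq_Gfun:
  assumes "i \<le> m"
    and "pochhammer (c - a - of_nat m) m \<noteq> 0" "pochhammer (c - b - of_nat m) m \<noteq> 0"
  defines "s \<equiv> c - a - b - of_nat m"
  shows "(\<Sum>k\<le>n. of_nat (n choose k) * (of_nat (k choose i) * (pochhammer s (n - k) * pochhammer a k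
      * pochhammer b k * pochhammer (c + of_nat k) (n - k)))) * fact i =
    pochhammer (c - a - of_nat m) n * pochhammer (c - b - of_nat m) n
      * ((-1) ^ i * pochhammer a i * pochhammer b i * pochhammer (- of_nat n) i
        / (pochhammer (c - a - of_nat m) i * pochhammer (c - b - of_nat m) i)
        * Gfun a b c m i (- of_nat n))"
proof (cases "i \<le> n")
  \<comment> \<open>For \<open>i > n\<close> both sides are 0: on the left through
    \<open>k choose i\<close>, on the right through (-n)_i.\<close>
  case False
  thus ?thesis
    by (simp add: pochhammer_of_nat_eq_0_lemma binomial_eq_0 cong: sum.cong_simp)
next
  case True
  define N where "N = n - i"
  \<comment> \<open>The transformation will be used with \<open>a + i\<close>, \<open>b + i\<close>
    and \<open>d = i - m\<close>, the value for which its shifted parameter becomes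
    \<open>c + i\<close>.\<close>
  have "s + (a + of_nat i) + (b + of_nat i) - (of_nat i - of_nat m) + of_nat k = c + of_nat (i + k)" for k
    by (simp add: s_def)
  note shift = this diff_diff_left
  have "(\<Sum>k\<le>n. of_nat (n choose k) * (of_nat (k choose i) * (pochhammer s (n - k) * pochhammer a k
      * pochhammer b k * pochhammer (c + of_nat k) (n - k)))) =
      of_nat (n choose i) * (\<Sum>k\<le>N. of_nat (N choose k) * (pochhammer s (n - (i + k))
        * pochhammer a (i + k) * pochhammer b (i + k) * pochhammer (c + of_nat (i + k)) (n - (i + k))))"
    unfolding N_def by (rule sum_binomial_times_choose[OF True])
  also have "\<dots> =
      of_nat (n choose i) * pochhammer a i * pochhammer b i *
      (\<Sum>k\<le>N. of_nat (N choose k) * (pochhammer s (N - k) * pochhammer (a + of_nat i) k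
        * pochhammer (b + of_nat i) k
        * pochhammer (s + (a + of_nat i) + (b + of_nat i) - (of_nat i - of_nat m) + of_nat k) (N - k)))"
    by (simp only: shift N_def pochhammer_product'[of _ i] sum_distrib_left mult_ac)
  also have "\<dots> = of_nat (n choose i) * pochhammer a i * pochhammer b i *
      (\<Sum>l\<le>N. of_nat (N choose l) * ((-1) ^ l * pochhammer (of_nat i - of_nat m) l * pochhammer s l
      * pochhammer (s + (a + of_nat i) + of_nat l) (N - l)
      * pochhammer (s + (b + of_nat i) + of_nat l) (N - l)))"
    unfolding terminating_3F2_transform ..
  also have "s + (a + of_nat i) = c - b - of_nat m + of_nat i"
    by (simp add: s_def)
  also have "s + (b + of_nat i) = c - a - of_nat m + of_nat i"
    by (simp add: s_def)
  also note Gfun_eq_sum[OF assms(1) True assms(2,3), folded s_def N_def, symmetric]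
  finally show ?thesis
    by (simp add: pochhammer_minus_of_nat[of n] mult_ac)
qed

section \<open>Evaluation of the series through \<open>Qhat\<close>\<close>

lemma prod_list_map_upt: "(\<Prod>x\<leftarrow>map g [1..<r+1]. h x) = (\<Prod>j=1..r. h (g j))"
  for h :: "'a \<Rightarrow> 'b::comm_monoid_mult"
proof -
  have "(\<Prod>x\<leftarrow>map g [1..<r+1]. h x) = prod_list (map (\<lambda>j. h (g j)) [1..<r+1])"
    by (simp add: o_def)
  also have "\<dots> = (\<Prod>j\<in>set [1..<r+1]. h (g j))"
    by (subst prod.distinct_set_conv_list) simp_all
  finally show ?thesis by (simp add: atLeastLessThanSuc_atLeastAtMost del: upt_Suc)
qed

text \<open>Each summand factors into a Newton expansion in \<open>k\<close> (\<open>ratio\<close>)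
  and a binomially weighted term (\<open>summand\<close>). Swapping the sums over \<open>k\<close>
  and \<open>i\<close> isolates the contribution of each \<open>Ccoeff i\<close>.\<close>

lemma hypergeom_eq_Qhat:
  fixes f :: "nat \<Rightarrow> complex" and ms :: "nat \<Rightarrow> nat"
  assumes m: "m = msum r ms"
    and c: "pochhammer c n \<noteq> 0"
    and s: "pochhammer (c - a - b - of_nat m) n \<noteq> 0"
    and fn: "\<And>j. j \<in> {1..r} \<Longrightarrow> pochhammer (f j) n \<noteq> 0"
    and fm: "\<And>j. j \<in> {1..r} \<Longrightarrow> pochhammer (f j) (ms j) \<noteq> 0"
    and A: "pochhammer (c - a - of_nat m) m \<noteq> 0"
    and B: "pochhammer (c - b - of_nat m) m \<noteq> 0"
  shows "hypergeom ([- of_nat n, a, b] @ map (\<lambda>j. f j + of_nat (ms j)) [1..<r+1])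
        ([c, of_nat m - of_nat n - (c - a - b - 1)] @ map f [1..<r+1]) 1
      = pochhammer (c - a - of_nat m) n * pochhammer (c - b - of_nat m) n
          / (pochhammer c n * pochhammer (c - a - b - of_nat m) n) * Qhat a b c r f ms (- of_nat n)"
    (is "?F = _")
proof -
  define s where "s = c - a - b - of_nat m"
  define w where "w = (\<lambda>k. pochhammer s (n - k) * pochhammer a k
      * pochhammer b k * pochhammer (c + of_nat k) (n - k))"
  have Lam: "Lam r f ms \<noteq> 0"
    using fm by (simp add: Lam_def)
  have ratio: "(\<Prod>j=1..r. pochhammer (f j + of_nat (ms j)) k) / (\<Prod>j=1..r. pochhammer (f j) k) =
      (\<Sum>i\<le>m. Ccoeff r f ms i * (fact i * of_nat (k choose i)))" if "k \<le> n" for k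
  proof -
    have "pochhammer (f j) k \<noteq> 0" if "j \<in> {1..r}" for j
      using fn[OF that] \<open>k \<le> n\<close> by (rule pochhammer_neq_0_mono)
    hence "(\<Prod>j=1..r. pochhammer (f j) k) \<noteq> 0"
      by simp
    \<comment> \<open>Both sides are the product of the (f_j)_(m_j+k), split after
      \<open>m_j\<close> or after \<open>k\<close> factors.\<close>
    moreover have "Lam r f ms * (\<Prod>j=1..r. pochhammer (f j + of_nat (ms j)) k) =
        (\<Prod>j=1..r. pochhammer (f j) k) * (\<Prod>j=1..r. pochhammer (f j + of_nat k) (ms j))"
      unfolding Lam_def prod.distrib[symmetric] pochhammer_product'[symmetric]
      by (simp add: add.commute)
    ultimately show ?thesis
      using Lam unfolding prod_pochhammer_shift_eq_Ccoeff[OF Lam] m by (simp add: field_simps)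
  qed
  have summand: "pochhammer (- of_nat n) k * pochhammer a k * pochhammer b k
      / (pochhammer c k * pochhammer (of_nat m - of_nat n - (c - a - b - 1)) k) / fact k =
      of_nat (n choose k) * w k / (pochhammer c n * pochhammer s n)" if k: "k \<le> n" for k
  proof -
    have c_split: "pochhammer c n = pochhammer c k * pochhammer (c + of_nat k) (n - k)"
      using k by (rule pochhammer_product)
    have "pochhammer s n = pochhammer s (n - k) * pochhammer (s + of_nat n - of_nat k) k"
      using pochhammer_product[of "n - k" n s] k by (simp add: of_nat_diff algebra_simps)
    \<comment> \<open>This lower parameter equals \<open>1 - s - n\<close>. Reflection gives a sign
      that cancels the one of (-n)_k, and a factor of (s)_n, hence a nonzero denominator.\<close>
    moreover have "pochhammer (of_nat m - of_nat n - (c - a - b - 1)) k =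
        (-1) ^ k * pochhammer (s + of_nat n - of_nat k) k"
      using pochhammer_minus[of "s + of_nat n - 1" k] by (simp add: s_def algebra_simps)
    ultimately show ?thesis
      using c s c_split unfolding s_def[symmetric] w_def pochhammer_minus_of_nat
      by (simp add: field_simps)
  qed
  have "?F = (\<Sum>k\<le>n. (pochhammer (- of_nat n) k * pochhammer a k * pochhammer b k
      / (pochhammer c k * pochhammer (of_nat m - of_nat n - (c - a - b - 1)) k) / fact k) *
      ((\<Prod>j=1..r. pochhammer (f j + of_nat (ms j)) k) / (\<Prod>j=1..r. pochhammer (f j) k)))"
    unfolding append.simps hypergeom_terminating list.map(2) prod_list.Cons prod_list_map_upt
    by (simp add: mult_ac)
  also have "\<dots> = (\<Sum>k\<le>n. of_nat (n choose k) * w k / (pochhammer c n * pochhammer s n) *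
      (\<Sum>i\<le>m. Ccoeff r f ms i * (fact i * of_nat (k choose i))))"
    by (intro sum.cong refl) (simp only: summand ratio atMost_iff)
  also have "\<dots> = (\<Sum>k\<le>n. \<Sum>i\<le>m. Ccoeff r f ms i *
      (of_nat (n choose k) * (of_nat (k choose i) * w k) * fact i)) / (pochhammer c n * pochhammer s n)"
    by (simp add: sum_distrib_left sum_divide_distrib mult_ac)
  also have "\<dots> = (\<Sum>i\<le>m. Ccoeff r f ms i *
      ((\<Sum>k\<le>n. of_nat (n choose k) * (of_nat (k choose i) * w k)) * fact i))
      / (pochhammer c n * pochhammer s n)"
    by (subst sum.swap) (simp add: sum_distrib_left sum_distrib_right)
  also have "\<dots> = (\<Sum>i\<le>m. Ccoeff r f ms i *
      (pochhammer (c - a - of_nat m) n * pochhammer (c - b - of_nat m) n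
      * ((-1) ^ i * pochhammer a i * pochhammer b i * pochhammer (- of_nat n) i
        / (pochhammer (c - a - of_nat m) i * pochhammer (c - b - of_nat m) i)
        * Gfun a b c m i (- of_nat n)))) / (pochhammer c n * pochhammer s n)"
    unfolding w_def s_def
    by (intro arg_cong2[of _ _ _ _ "(/)"] sum.cong refl arg_cong2[of _ _ _ _ "(*)"]
          sum_binomial_choose_eq_Gfun A B) auto
  also have "\<dots> = pochhammer (c - a - of_nat m) n * pochhammer (c - b - of_nat m) n
      / (pochhammer c n * pochhammer s n) * Qhat a b c r f ms (- of_nat n)"
    unfolding Qhat_def Let_def m[symmetric] atMost_atLeast0[symmetric]
    by (simp add: sum_distrib_left sum_divide_distrib mult_ac)
  finally show ?thesis by (simp add: s_def)
qed

section \<open>Passage to the zeros of the polynomial\<close>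

text \<open>Over the complex numbers the polynomial splits into linear factors, and division by its
  value at 0 cancels the leading coefficient. The equality of multisets accounts for
  multiplicities.\<close>

lemma poly_div_poly_0_eq_prod_roots:
  fixes p :: "complex poly" and \<eta> :: "'b \<Rightarrow> complex"
  assumes "poly p 0 \<noteq> 0" "image_mset \<eta> (mset_set I) = proots p"
  shows "poly p x / poly p 0 = (\<Prod>j\<in>I. (\<eta> j - x) / \<eta> j)"
proof -
  have eval: "poly p y = lead_coeff p * (\<Prod>j\<in>I. y - \<eta> j)" for y
  proof -
    have "p = smult (lead_coeff p) (\<Prod>j\<in>I. [:- \<eta> j, 1:])"
      using complex_poly_decompose_multiset[of p]
      by (simp add: assms(2)[symmetric] image_mset.compositionality o_def prod_unfold_prod_mset)
    hence "poly p y = poly (smult (lead_coeff p) (\<Prod>j\<in>I. [:- \<eta> j, 1:])) y"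
      by metis
    thus ?thesis by (simp add: poly_prod)
  qed
  have "lead_coeff p \<noteq> 0" using assms(1) by auto
  hence "poly p x / poly p 0 = (\<Prod>j\<in>I. (x - \<eta> j) / (0 - \<eta> j))"
    by (simp only: eval prod_dividef) simp
  also have "\<dots> = (\<Prod>j\<in>I. (\<eta> j - x) / \<eta> j)"
    by (intro prod.cong refl) (metis diff_0 minus_diff_eq minus_divide_divide)
  finally show ?thesis .
qed

theorem theorem1:
  fixes r n m :: nat and ms :: "nat \<Rightarrow> nat"
    and a b c \<sigma> :: complex and f \<eta> :: "nat \<Rightarrow> complex"
  assumes ms_pos: "\<And>j. j \<in> {1..r} \<Longrightarrow> ms j > 0"
    and m_def: "m = msum r ms"
    and sigma_def: "\<sigma> = c - a - b - 1"
    and "pochhammer c n \<noteq> 0"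
    and "pochhammer (c - a - b - of_nat m) n \<noteq> 0"
    and "\<And>j. j \<in> {1..r} \<Longrightarrow> pochhammer (f j) n \<noteq> 0"
    and "\<And>j. j \<in> {1..r} \<Longrightarrow> pochhammer (f j) (ms j) \<noteq> 0"
    and "pochhammer (c - a - of_nat m) m \<noteq> 0"
    and "pochhammer (c - b - of_nat m) m \<noteq> 0"
    and degree: "degree (Qhat_poly a b c r f ms) = m"
    and zeros: "image_mset \<eta> (mset_set {1..m}) = proots (Qhat_poly a b c r f ms)"
  shows "(\<forall>j\<in>{1..m}. \<eta> j \<noteq> 0) \<and>
    hypergeom ([- of_nat n, a, b] @ map (\<lambda>j. f j + of_nat (ms j)) [1..<r+1])
        ([c, of_nat m - of_nat n - \<sigma>] @ map f [1..<r+1]) 1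
      = pochhammer (c - a - of_nat m) n * pochhammer (c - b - of_nat m) n
          / (pochhammer c n * pochhammer (c - a - b - of_nat m) n) * Hprod m \<eta> n \<and>
    Hprod m \<eta> n = Qhat a b c r f ms (- of_nat n)"
proof -
  define p where "p = Qhat_poly a b c r f ms"
  have hyp: "hypergeom ([- of_nat n, a, b] @ map (\<lambda>j. f j + of_nat (ms j)) [1..<r+1])
        ([c, of_nat m - of_nat n - \<sigma>] @ map f [1..<r+1]) 1
      = pochhammer (c - a - of_nat m) n * pochhammer (c - b - of_nat m) n
          / (pochhammer c n * pochhammer (c - a - b - of_nat m) n) * Qhat a b c r f ms (- of_nat n)"
    unfolding sigma_def by (rule hypergeom_eq_Qhat) (use assms in auto)
  \<comment> \<open>For \<open>n = 0\<close> both the series and its prefactor are trivial, so the same identity gives \<open>Q(0) = 1\<close>.\<close>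
  have "Qhat a b c r f ms (- of_nat 0) =
      hypergeom ([- of_nat 0, a, b] @ map (\<lambda>j. f j + of_nat (ms j)) [1..<r+1])
        ([c, of_nat m - of_nat 0 - (c - a - b - 1)] @ map f [1..<r+1]) 1"
    by (subst hypergeom_eq_Qhat[where m = m and n = 0]) (use assms in auto)
  also have "\<dots> = 1"
    unfolding append.simps hypergeom_terminating list.map(2) prod_list.Cons prod_list_map_upt
    by simp
  finally have p0: "poly p 0 = 1"
    by (simp add: p_def poly_Qhat_poly)
  have "\<eta> j \<noteq> 0" if "j \<in> {1..m}" for j
  proof -
    have "\<eta> j \<in># image_mset \<eta> (mset_set {1..m})"
      using that by simp
    hence "\<eta> j \<in># proots p"
      unfolding zeros p_def .
    moreover have "p \<noteq> 0" using p0 by auto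
    ultimately show ?thesis using p0 by (auto simp: set_count_proots)
  qed
  \<comment> \<open>At \<open>x = -n\<close> the factors \<open>(\<eta> j - x) / \<eta> j\<close>
    are those of \<open>Hprod\<close>, and the divisor \<open>poly p 0\<close> is 1.\<close>
  moreover have "Hprod m \<eta> n = Qhat a b c r f ms (- of_nat n)"
    using poly_div_poly_0_eq_prod_roots[of p \<eta> "{1..m}" "- of_nat n"] p0 zeros
    by (simp add: p_def poly_Qhat_poly Hprod_def add.commute)
  ultimately show ?thesis using hyp by simp
qed

end
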